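(* Let $k\le n$, let $H:\mathbb{R}^{2n}\to\mathbb{R}$ be a smooth Hamiltonian function and $f_H:\mathbb{R}^{2n}\to\mathbb{R}^n$ a smooth force field, and let $A=\begin{bmatrix} A_{qq} & A_{qp} \\ A_{pq} & A_{pp} \end{bmatrix}\in\mathbb{R}^{2n\times 2k}$ (blocks in $\mathbb{R}^{n\times k}$) satisfy $A^TJ_{2n}A=J_{2k}$ and $A_{qp}=0$. Then the reduced system constructed by the variational principle and the reduced system constructed by the structure-preserving projection are the same system of ordinary differential equations for $z=(r,s)\in\mathbb{R}^{2k}$, i.e. they have the same vector field on $\mathbb{R}^{2k}$.
   Context: $J_{2m}=\begin{bmatrix} 0_m & I_m \\ -I_m & 0_m \end{bmatrix}$. The full system on $\mathbb{R}^{2n}$, with $x=(q,p)$, is $\dot x=X_H(x)+X_F(x)$, where $X_H(x)=J_{2n}\nabla_xH(x)$ and $X_F(x)=(0,f_H(x))$. Variational principle: with $\tilde H(z)=H(Az)$, $\tilde f_H(z)=f_H(Az)$, $z=(r,s)$, and $$M=\begin{bmatrix} A_{pq}^TA_{qq}-A_{qq}^TA_{pq} & A_{pq}^TA_{qp}-A_{qq}^TA_{pp} \\ A_{pp}^TA_{qq}-A_{qp}^TA_{pq} & A_{pp}^TA_{qp}-A_{qp}^TA_{pp} \end{bmatrix}$$ (invertible when $A^TJ_{2n}A=J_{2k}$), the reduced system constructed by the variational principle is $$\begin{bmatrix} \dot r \\ \dot s \end{bmatrix}=M^{-1}\begin{bmatrix} \nabla_r\tilde H(r,s) \\ \nabla_s\tilde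 H(r,s) \end{bmatrix}-M^{-1}\begin{bmatrix} A_{qq}^T\tilde f_H(r,s) \\ A_{qp}^T\tilde f_H(r,s) \end{bmatrix}.$$ Structure-preserving projection: with $A^+=J_{2k}^TA^TJ_{2n}\in\mathbb{R}^{2k\times 2n}$, the reduced system constructed by the structure-preserving projection is $\dot z=A^+X_H(Az)+A^+X_F(Az)$. *)

theory Defs
  imports "HOL-Analysis.Analysis"
begin

text \<open>
  The space of dimension \<open>2m\<close> is \<^typ>\<open>real ^ ('m + 'm)\<close>: the coordinates \<open>Inl i\<close> form the first
  half (\<open>q\<close>, resp. \<open>r\<close>) and the coordinates \<open>Inr i\<close> the second half (\<open>p\<close>, resp. \<open>s\<close>).
\<close>

definition vjoin :: "'a ^ 'm::finite \<Rightarrow> 'a ^ 'n::finite \<Rightarrow> 'a ^ ('m + 'n)" where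
  "vjoin u v = (\<chi> i. case i of Inl a \<Rightarrow> u $ a | Inr b \<Rightarrow> v $ b)"

definition vfirst :: "'a ^ ('m::finite + 'n::finite) \<Rightarrow> 'a ^ 'm" where
  "vfirst x = (\<chi> i. x $ Inl i)"

definition vsecond :: "'a ^ ('m::finite + 'n::finite) \<Rightarrow> 'a ^ 'n" where
  "vsecond x = (\<chi> i. x $ Inr i)"

definition block_matrix ::
  "'a ^ 'c::finite ^ 'r::finite \<Rightarrow> 'a ^ 'd::finite ^ 'r \<Rightarrow> 'a ^ 'c ^ 's::finite \<Rightarrow> 'a ^ 'd ^ 's \<Rightarrow> 'a ^ ('c + 'd) ^ ('r + 's)" where
  "block_matrix P Q R S = vjoin (\<chi> i. vjoin (P $ i) (Q $ i)) (\<chi> i. vjoin (R $ i) (S $ i))"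

definition J_mat :: "real ^ ('m::finite + 'm) ^ ('m + 'm)" where
  "J_mat = block_matrix 0 (mat 1) (- mat 1) 0"

definition gradient :: "('a::real_inner \<Rightarrow> real) \<Rightarrow> 'a \<Rightarrow> 'a" where
  "gradient f x = (THE D. GDERIV f x :> D)"

fun C_diff :: "nat \<Rightarrow> ('a::real_normed_vector \<Rightarrow> 'b::real_normed_vector) \<Rightarrow> bool" where
  "C_diff 0 f \<longleftrightarrow> continuous_on UNIV f"
| "C_diff (Suc j) f \<longleftrightarrow>
     (\<forall>x. f differentiable at x) \<and> (\<forall>v. C_diff j (\<lambda>x. frechet_derivative f (at x) v))"

definition smooth :: "('a::real_normed_vector \<Rightarrow> 'b::real_normed_vector) \<Rightarrow> bool" where
  "smooth f \<longleftrightarrow> (\<forall>j. C_diff j f)"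

definition X_H :: "(real ^ ('n::finite + 'n) \<Rightarrow> real) \<Rightarrow> real ^ ('n + 'n) \<Rightarrow> real ^ ('n + 'n)" where
  "X_H H x = J_mat *v gradient H x"

definition X_F :: "(real ^ ('n::finite + 'n) \<Rightarrow> real ^ 'n) \<Rightarrow> real ^ ('n + 'n) \<Rightarrow> real ^ ('n + 'n)" where
  "X_F f x = vjoin 0 (f x)"

definition M_mat ::
  "real ^ 'k ^ 'n \<Rightarrow> real ^ 'k ^ 'n \<Rightarrow> real ^ 'k ^ 'n \<Rightarrow> real ^ 'k ^ 'n \<Rightarrow>
     real ^ ('k::finite + 'k) ^ ('k + 'k)" where
  "M_mat Aqq Aqp Apq App =
     block_matrix
       (transpose Apq ** Aqq - transpose Aqq ** Apq) (transpose Apq ** Aqp - transpose Aqq ** App)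
       (transpose App ** Aqq - transpose Aqp ** Apq) (transpose App ** Aqp - transpose Aqp ** App)"

definition variational_reduced_field ::
  "(real ^ ('n::finite + 'n) \<Rightarrow> real) \<Rightarrow> (real ^ ('n + 'n) \<Rightarrow> real ^ 'n) \<Rightarrow>
   real ^ 'k ^ 'n \<Rightarrow> real ^ 'k ^ 'n \<Rightarrow> real ^ 'k ^ 'n \<Rightarrow> real ^ 'k ^ 'n \<Rightarrow>
   real ^ ('k::finite + 'k) \<Rightarrow> real ^ ('k + 'k)" where
  "variational_reduced_field H f Aqq Aqp Apq App z =
     (let A = block_matrix Aqq Aqp Apq App;
          Ht = (\<lambda>z. H (A *v z));
          ft = (\<lambda>z. f (A *v z));
          r = vfirst z;
          s = vsecond z;
          Minv = matrix_inv (M_mat Aqq Aqp Apq App)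
      in Minv *v vjoin (gradient (\<lambda>r'. Ht (vjoin r' s)) r) (gradient (\<lambda>s'. Ht (vjoin r s')) s)
         - Minv *v vjoin (transpose Aqq *v ft (vjoin r s)) (transpose Aqp *v ft (vjoin r s)))"

definition symplectic_inverse ::
  "real ^ ('k::finite + 'k) ^ ('n::finite + 'n) \<Rightarrow> real ^ ('n + 'n) ^ ('k + 'k)" where
  "symplectic_inverse A = transpose J_mat ** transpose A ** J_mat"

definition projection_reduced_field ::
  "(real ^ ('n::finite + 'n) \<Rightarrow> real) \<Rightarrow> (real ^ ('n + 'n) \<Rightarrow> real ^ 'n) \<Rightarrow>
   real ^ ('k::finite + 'k) ^ ('n + 'n) \<Rightarrow> real ^ ('k + 'k) \<Rightarrow> real ^ ('k + 'k)" where
  "projection_reduced_field H f A z =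
     symplectic_inverse A *v X_H H (A *v z) + symplectic_inverse A *v X_F f (A *v z)"

text \<open>The following facts show that the description operators hidden in \<^const>\<open>gradient\<close> and
  \<^const>\<open>matrix_inv\<close> are well defined where they are used.\<close>

lemma gradient_eqI:
  assumes "GDERIV f x :> D"
  shows "gradient f x = D"
  unfolding gradient_def
proof (rule the_equality)
  fix E assume "GDERIV f x :> E"
  with assms have "(\<lambda>h. inner h E) = (\<lambda>h. inner h D)"
    unfolding gderiv_def by (rule has_derivative_unique[rotated])
  then have "inner (E - D) (E - D) = 0"
    by (metis inner_diff_right right_minus_eq)
  then show "E = D" by simp
qed (rule assms)

lemma gderiv_gradient:
  fixes f :: "'a::euclidean_space \<Rightarrow> real"
  assumes "f differentiable at x"
  shows "GDERIV f x :> gradient f x"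
proof -
  from assms obtain f' where f': "(f has_derivative f') (at x)"
    unfolding differentiable_def by blast
  then have "linear f'" by (rule has_derivative_linear)
  then have "f' = (\<lambda>h. inner h (adjoint f' 1))"
    using adjoint_works[of f' _ 1] by (simp add: fun_eq_iff)
  with f' have "GDERIV f x :> adjoint f' 1"
    unfolding gderiv_def by simp
  then show ?thesis by (simp add: gradient_eqI)
qed

lemma sum_UNIV_Plus:
  fixes g :: "'a::finite + 'b::finite \<Rightarrow> real"
  shows "sum g UNIV = (\<Sum>a\<in>UNIV. g (Inl a)) + (\<Sum>b\<in>UNIV. g (Inr b))"
  unfolding UNIV_Plus_UNIV[symmetric] by (subst sum.Plus) (auto simp: o_def)

lemma block_matrix_mult:
  fixes P Q R S P' Q' R' S' :: "real ^ _ ^ _"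
  shows "block_matrix P Q R S ** block_matrix P' Q' R' S' =
    block_matrix (P ** P' + Q ** R') (P ** Q' + Q ** S') (R ** P' + S ** R') (R ** Q' + S ** S')"
  by (auto simp: vec_eq_iff matrix_matrix_mult_def block_matrix_def vjoin_def sum_UNIV_Plus
      split: sum.split)

lemma transpose_block_matrix:
  "transpose (block_matrix P Q R S) =
    block_matrix (transpose P) (transpose R) (transpose Q) (transpose S)"
  by (auto simp: vec_eq_iff transpose_def block_matrix_def vjoin_def split: sum.split)

lemma uminus_block_matrix:
  fixes P Q R S :: "real ^ _ ^ _"
  shows "- block_matrix P Q R S = block_matrix (- P) (- Q) (- R) (- S)"
  by (auto simp: vec_eq_iff block_matrix_def vjoin_def split: sum.split)

lemma matrix_mult_uminus_right:
  fixes P :: "real ^ 'm ^ 'n" and Q :: "real ^ 'l ^ 'm"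
  shows "P ** (- Q) = - (P ** Q)"
  by (simp add: vec_eq_iff matrix_matrix_mult_def sum_negf)

lemma matrix_mult_uminus_left:
  fixes P :: "real ^ 'm ^ 'n" and Q :: "real ^ 'l ^ 'm"
  shows "(- P) ** Q = - (P ** Q)"
  by (simp add: vec_eq_iff matrix_matrix_mult_def sum_negf)

lemma M_mat_eq:
  fixes Aqq Aqp Apq App :: "real ^ 'k::finite ^ 'n::finite"
  defines "A \<equiv> block_matrix Aqq Aqp Apq App"
  shows "M_mat Aqq Aqp Apq App = - (transpose A ** J_mat ** A)"
  unfolding A_def M_mat_def J_mat_def
  by (simp add: transpose_block_matrix block_matrix_mult uminus_block_matrix
      matrix_mult_uminus_right matrix_mult_uminus_left)

lemma J_mat_square: "J_mat ** J_mat = - mat 1"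
proof -
  have *: "mat 1 = (block_matrix (mat 1) 0 0 (mat 1) :: real ^ ('m::finite + 'm) ^ ('m + 'm))"
    by (auto simp: vec_eq_iff mat_def block_matrix_def vjoin_def split: sum.split)
  show ?thesis
    unfolding * uminus_block_matrix unfolding J_mat_def
    by (simp add: block_matrix_mult matrix_mult_uminus_right matrix_mult_uminus_left)
qed

lemma invertible_M_mat:
  fixes Aqq Aqp Apq App :: "real ^ 'k::finite ^ 'n::finite"
  defines "A \<equiv> block_matrix Aqq Aqp Apq App"
  assumes "transpose A ** J_mat ** A = J_mat"
  shows "invertible (M_mat Aqq Aqp Apq App)"
proof -
  have "M_mat Aqq Aqp Apq App = - J_mat"
    using assms M_mat_eq[of Aqq Aqp Apq App] by simp
  then show ?thesis
    unfolding invertible_def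
    by (intro exI[of _ J_mat])
       (simp add: matrix_mult_uminus_right matrix_mult_uminus_left J_mat_square)
qed

end

theory Submission
  imports Defs
begin

text \<open>
  Symplecticity of \<open>A\<close> says \<open>M = - J\<close>, hence \<open>M\<^sup>-\<^sup>1 = J\<close>. By the chain rule the gradient of
  \<open>z \<mapsto> H (A z)\<close> is \<open>A\<^sup>T \<nabla>H (A z)\<close>, and the force vector of the variational system is
  \<open>A\<^sup>T (f, 0) = A\<^sup>T J (0, f)\<close>. Both vector fields therefore equal
  \<open>J A\<^sup>T (\<nabla>H (A z) - (f (A z), 0))\<close>, using \<open>J\<^sup>T = - J\<close> and \<open>J\<^sup>2 = - I\<close>.
\<close>

lemma vjoin_vfirst_vsecond: "vjoin (vfirst x) (vsecond x) = x"
  by (auto simp: vec_eq_iff vjoin_def vfirst_def vsecond_def split: sum.split)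

lemma inner_vjoin_left:
  fixes x :: "real ^ ('m::finite + 'n::finite)"
  shows "inner (vjoin u v) x = inner u (vfirst x) + inner v (vsecond x)"
  by (simp add: inner_vec_def sum_UNIV_Plus vjoin_def vfirst_def vsecond_def)

lemma block_matrix_vjoin:
  fixes P Q R S :: "real ^ _ ^ _"
  shows "block_matrix P Q R S *v vjoin u v = vjoin (P *v u + Q *v v) (R *v u + S *v v)"
  by (auto simp: vec_eq_iff matrix_vector_mult_def block_matrix_def vjoin_def sum_UNIV_Plus
      split: sum.split)

text \<open>Fixing one half leaves an affine map: a linear embedding plus the constant
  \<open>vjoin 0 v\<close>, which the derivative drops.\<close>

lemma has_derivative_vjoin_left:
  fixes v :: "real ^ 'n::finite" and r :: "real ^ 'm::finite"
  shows "((\<lambda>u. vjoin u v) has_derivative (\<lambda>h. vjoin h 0)) (at r)"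
proof -
  have "linear (\<lambda>u::real ^ 'm. vjoin u (0::real ^ 'n))"
    by (rule linearI) (auto simp: vec_eq_iff vjoin_def split: sum.split)
  then have "((\<lambda>u. vjoin u 0 + vjoin 0 v) has_derivative (\<lambda>h. vjoin h 0)) (at r)"
    by (intro has_derivative_add_const linear_imp_has_derivative)
  moreover have "(\<lambda>u::real ^ 'm. vjoin u 0 + vjoin 0 v) = (\<lambda>u. vjoin u v)"
    by (auto simp: fun_eq_iff vec_eq_iff vjoin_def split: sum.split)
  ultimately show ?thesis by simp
qed

lemma has_derivative_vjoin_right:
  fixes u :: "real ^ 'm::finite" and s :: "real ^ 'n::finite"
  shows "((\<lambda>v. vjoin u v) has_derivative (\<lambda>h. vjoin 0 h)) (at s)"
proof -
  have "linear (\<lambda>v::real ^ 'n. vjoin (0::real ^ 'm) v)"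
    by (rule linearI) (auto simp: vec_eq_iff vjoin_def split: sum.split)
  then have "((\<lambda>v. vjoin 0 v + vjoin u 0) has_derivative (\<lambda>h. vjoin 0 h)) (at s)"
    by (intro has_derivative_add_const linear_imp_has_derivative)
  moreover have "(\<lambda>v::real ^ 'n. vjoin 0 v + vjoin u 0) = (\<lambda>v. vjoin u v)"
    by (auto simp: fun_eq_iff vec_eq_iff vjoin_def split: sum.split)
  ultimately show ?thesis by simp
qed

text \<open>Chain rule: the derivative sends \<open>h\<close> to the inner product of
  \<open>A *v h\<close> with \<open>D\<close>, and moving \<open>A\<close> to the other factor
  transposes it.\<close>

lemma GDERIV_matrix_vector_mult:
  fixes A :: "real ^ 'k::finite ^ 'n::finite"
  assumes "GDERIV H (A *v z) :> D"
  shows "GDERIV (\<lambda>z. H (A *v z)) z :> transpose A *v D"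
proof -
  have "((\<lambda>z. H (A *v z)) has_derivative (\<lambda>h. inner (A *v h) D)) (at z)"
    using has_derivative_compose[OF linear_imp_has_derivative[OF matrix_vector_mul_linear]
        assms[unfolded gderiv_def]] .
  then show ?thesis
    by (simp add: gderiv_def dot_lmul_matrix[symmetric] inner_commute transpose_matrix_vector)
qed

text \<open>The adjoint of the embedding \<open>h\<close> to \<open>vjoin h 0\<close> is
  \<open>vfirst\<close>, so a partial gradient is a half of the full one.\<close>

lemma gradient_vjoin_left:
  fixes G :: "real ^ ('m::finite + 'n::finite) \<Rightarrow> real"
  assumes "GDERIV G (vjoin r s) :> D"
  shows "gradient (\<lambda>r'. G (vjoin r' s)) r = vfirst D"
  using has_derivative_compose[OF has_derivative_vjoin_left assms[unfolded gderiv_def]]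
  by (intro gradient_eqI) (simp add: gderiv_def inner_vjoin_left)

lemma gradient_vjoin_right:
  fixes G :: "real ^ ('m::finite + 'n::finite) \<Rightarrow> real"
  assumes "GDERIV G (vjoin r s) :> D"
  shows "gradient (\<lambda>s'. G (vjoin r s')) s = vsecond D"
  using has_derivative_compose[OF has_derivative_vjoin_right assms[unfolded gderiv_def]]
  by (intro gradient_eqI) (simp add: gderiv_def inner_vjoin_left)

text \<open>For square matrices a right inverse is two-sided. It thus witnesses the choice behind
  \<open>matrix_inv\<close>, and uniqueness of inverses identifies the chosen matrix.\<close>

lemma matrix_inv_eqI:
  fixes M N :: "real ^ 'n::finite ^ 'n"
  assumes "M ** N = mat 1"
  shows "matrix_inv M = N"
proof -
  have "N ** M = mat 1"
    using assms matrix_left_right_inverse by blast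
  with assms have "M ** N = mat 1 \<and> N ** M = mat 1" ..
  then have inv: "M ** matrix_inv M = mat 1 \<and> matrix_inv M ** M = mat 1"
    unfolding matrix_inv_def
    by (rule someI)
  have "matrix_inv M = matrix_inv M ** (M ** N)"
    by (simp add: assms)
  also have "\<dots> = N"
    using inv by (simp add: matrix_mul_assoc)
  finally show ?thesis .
qed

lemma transpose_J_mat: "transpose J_mat = - J_mat"
  by (auto simp: vec_eq_iff J_mat_def transpose_def block_matrix_def vjoin_def mat_def
      split: sum.split)

lemma uminus_matrix_vector_mult:
  fixes P :: "real ^ 'm::finite ^ 'n::finite"
  shows "(- P) *v x = - (P *v x)"
  by (simp add: vec_eq_iff matrix_vector_mult_def sum_negf)

lemma matrix_vector_mult_uminus:
  fixes P :: "real ^ 'm::finite ^ 'n::finite"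
  shows "P *v (- x) = - (P *v x)"
  by (simp add: vec_eq_iff matrix_vector_mult_def sum_negf)

lemma symplectic_inverse_mult:
  "symplectic_inverse A *v x = - (J_mat *v (transpose A *v (J_mat *v x)))"
  by (simp add: symplectic_inverse_def transpose_J_mat uminus_matrix_vector_mult
      matrix_vector_mul_assoc[symmetric])

lemma J_mat_J_mat_mult: "J_mat *v (J_mat *v x) = - x"
  by (simp add: matrix_vector_mul_assoc J_mat_square uminus_matrix_vector_mult)

text \<open>Used to carry the force from the momentum slot of \<open>X_F\<close> to the position
  slot, where the variational force sits.\<close>

lemma J_mat_vjoin: "J_mat *v vjoin u v = vjoin v (- u)"
  by (simp add: J_mat_def block_matrix_vjoin uminus_matrix_vector_mult)

theorem mainTheorem2:
  fixes H :: "real ^ ('n::finite + 'n) \<Rightarrow> real"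
    and f_H :: "real ^ ('n + 'n) \<Rightarrow> real ^ 'n"
    and A :: "real ^ ('k::finite + 'k) ^ ('n + 'n)"
    and Aqq Aqp Apq App :: "real ^ 'k ^ 'n"
  assumes "CARD('k) \<le> CARD('n)"
    and "smooth H"
    and "smooth f_H"
    and "A = block_matrix Aqq Aqp Apq App"
    and "transpose A ** J_mat ** A = J_mat"
    and "Aqp = 0"
  shows "variational_reduced_field H f_H Aqq Aqp Apq App = projection_reduced_field H f_H A"
proof
  fix z :: "real ^ ('k + 'k)"
  note A = assms(4)
  have "M_mat Aqq Aqp Apq App = - J_mat"
    using assms(5) M_mat_eq[of Aqq Aqp Apq App] A by simp
  then have Minv: "matrix_inv (M_mat Aqq Aqp Apq App) = J_mat"
    by (intro matrix_inv_eqI) (simp add: matrix_mult_uminus_left J_mat_square)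
  let ?D = "gradient H (A *v z)"
  \<comment> \<open>Order one of smoothness gives differentiability, so that \<open>?D\<close> is a
    genuine gradient.\<close>
  have "C_diff (Suc 0) H"
    using \<open>smooth H\<close> unfolding smooth_def by blast
  then have "GDERIV H (A *v z) :> ?D"
    by (intro gderiv_gradient) simp
  \<comment> \<open>The point \<open>z\<close> is split into its halves to match the partial
    gradients in the variational field.\<close>
  then have D: "GDERIV (\<lambda>z. H (A *v z)) (vjoin (vfirst z) (vsecond z)) :> transpose A *v ?D"
    unfolding vjoin_vfirst_vsecond by (rule GDERIV_matrix_vector_mult)
  have force: "transpose A *v vjoin (f_H (A *v z)) 0 =
      vjoin (transpose Aqq *v f_H (A *v z)) (transpose Aqp *v f_H (A *v z))"
    by (simp add: A transpose_block_matrix block_matrix_vjoin)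
  have "variational_reduced_field H f_H Aqq Aqp Apq App z =
      J_mat *v (transpose A *v ?D) - J_mat *v (transpose A *v vjoin (f_H (A *v z)) 0)"
    unfolding variational_reduced_field_def Let_def Minv A[symmetric]
      gradient_vjoin_left[OF D] gradient_vjoin_right[OF D] vjoin_vfirst_vsecond force ..
  \<comment> \<open>In the Hamiltonian term \<open>J_mat\<close> squared cancels the minus sign of
    \<open>symplectic_inverse_mult\<close>; in the force term that sign survives and yields the
    subtraction.\<close>
  also have "\<dots> = projection_reduced_field H f_H A z"
    by (simp add: projection_reduced_field_def symplectic_inverse_mult X_H_def X_F_def
        J_mat_J_mat_mult J_mat_vjoin matrix_vector_mult_uminus)
  finally show "variational_reduced_field H f_H Aqq Aqp Apq App z =
      projection_reduced_field H f_H A z" .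
qed

end
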